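(* Let $K\subset\mathbb{R}^3$ be a finite union $K=D_1\cup\cdots\cup D_k$ where each $D_i$ is a simplicial $2$-complex. Then there exist $N\in\mathbb{N}$ and a bi-Lipschitz embedding of $(K,d_{\mathbb{H}})$ into $\mathbb{R}^N$.
   Context: A $0$-simplex is a point of $\mathbb{R}^3$, a $1$-simplex is the convex hull of two distinct points, a $2$-simplex is the convex hull of three non-collinear points. A (compact) simplicial $2$-complex $K\subset\mathbb{R}^3$ is a finite union $S_1\cup\dots\cup S_n$ where each $S_i$ is a $k_i$-simplex, $k_i\in\{0,1,2\}$, and for all $i,j$ either $S_i\cap S_j=\emptyset$, or $S_i\cap S_j$ is a common edge of $S_i$ and $S_j$, or $S_i=S_j$. For $w=(x,y,z)$, $w'=(x',y',z')$, $d_{\mathbb{H}}(w,w')=|x-x'|+|y-y'|+|z-z'+\tfrac12(xy'-x'y)|^{1/2}$. A map $f$ from $(A,d_{\mathbb{H}})$ to $\mathbb{R}^N$ is a bi-Lipschitz embedding if $L^{-1}d_{\mathbb{H}}(a,b)\le|f(a)-f(b)|\le Ld_{\mathbb{H}}(a,b)$ for all $a,b\in A$ and some $L\ge1$. *)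

theory Defs
  imports "HOL-Analysis.Analysis"
begin

text \<open>A simplex is given by its vertex set V; the simplex itself is convex hull V.
  0-simplex: one point; 1-simplex: two distinct points; 2-simplex: three non-collinear points.\<close>
definition simplex_verts :: "(real^3) set \<Rightarrow> bool" where
  "simplex_verts V \<longleftrightarrow> finite V \<and>
     (card V = 1 \<or> card V = 2 \<or> (card V = 3 \<and> \<not> collinear V))"

definition is_edge_of :: "(real^3) set \<Rightarrow> (real^3) set \<Rightarrow> bool" where
  "is_edge_of E V \<longleftrightarrow> (\<exists>W. W \<subseteq> V \<and> card W = 2 \<and> E = convex hull W)"

definition simplicial_2_complex :: "(real^3) set \<Rightarrow> bool" where
  "simplicial_2_complex K \<longleftrightarrow>
     (\<exists>Ss. finite Ss \<and> (\<forall>V\<in>Ss. simplex_verts V) \<and>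
        K = (\<Union>V\<in>Ss. convex hull V) \<and>
        (\<forall>V\<in>Ss. \<forall>W\<in>Ss.
           convex hull V \<inter> convex hull W = {} \<or>
           (\<exists>E. is_edge_of E V \<and> is_edge_of E W \<and> convex hull V \<inter> convex hull W = E) \<or>
           convex hull V = convex hull W))"

definition dH :: "real^3 \<Rightarrow> real^3 \<Rightarrow> real" where
  "dH w w' = \<bar>w$1 - w'$1\<bar> + \<bar>w$2 - w'$2\<bar> +
     sqrt \<bar>w$3 - w'$3 + (w$1 * w'$2 - w'$1 * w$2) / 2\<bar>"

definition eucl_dist :: "nat \<Rightarrow> (nat \<Rightarrow> real) \<Rightarrow> (nat \<Rightarrow> real) \<Rightarrow> real" where
  "eucl_dist N x y = sqrt (\<Sum>i<N. (x i - y i)^2)"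

end

theory Submission
  imports Defs
begin

text \<open>Bi-Lipschitz embeddability into some \<open>\<real>\<^sup>N\<close> passes to finite unions: extend the coordinates of
  each piece by McShane's formula and add the distance to one piece as a further coordinate. So it
  suffices to embed bounded subsets of planes. A vertical plane carries a product of a line with
  the snowflake \<open>\<bar>s - t\<bar>\<^sup>1\<^sup>/\<^sup>2\<close>; any other plane looks, around its characteristic point, like a cone
  over a snowflake. The snowflake is embedded by lacunary Fourier series.\<close>

text \<open>The full Heisenberg group has no bi-Lipschitz embedding into any R^N, so the argument
  must exploit that each piece is two-dimensional. The difficulty sits at the characteristic point
  of a non-vertical plane, where the plane is horizontal: lines of the plane through that point
  carry the Euclidean metric, whereas a change of direction costs a square root, weighted by the
  distance from the point. Hence a cone, with the radius as a factor in front of the snowflake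
  coordinates. Points of different simplices are never compared geometrically; the union argument
  takes care of them, but it rests on the triangle inequality, hence the detour through
  \<open>heis_dist\<close>. Boundedness enters only for vertical planes: the lacunary series has a
  lowest frequency and separates points of a bounded interval only, and directions seen from a
  characteristic point range over such an interval anyway.\<close>

section \<open>Coordinates for the maximum norm\<close>

text \<open>The finite set \<open>\<Phi>\<close> plays the role of the coordinate functions, with the target carrying the
  maximum norm.\<close>
definition bilip_coords :: "('a \<Rightarrow> 'a \<Rightarrow> real) \<Rightarrow> 'a set \<Rightarrow> ('a \<Rightarrow> real) set \<Rightarrow> real \<Rightarrow> bool" where
  "bilip_coords \<rho> A \<Phi> L \<longleftrightarrow> finite \<Phi> \<and> L \<ge> 1 \<and>
     (\<forall>f\<in>\<Phi>. \<forall>a\<in>A. \<forall>b\<in>A. \<bar>f a - f b\<bar> \<le> L * \<rho> a b) \<and>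
     (\<forall>a\<in>A. \<forall>b\<in>A. \<exists>f\<in>\<Phi>. \<rho> a b \<le> L * \<bar>f a - f b\<bar>)"

definition bilip_embeddable :: "('a \<Rightarrow> 'a \<Rightarrow> real) \<Rightarrow> 'a set \<Rightarrow> bool" where
  "bilip_embeddable \<rho> A \<longleftrightarrow> (\<exists>\<Phi> L. bilip_coords \<rho> A \<Phi> L)"

lemma bilip_embeddableE:
  assumes "bilip_embeddable \<rho> A"
  obtains \<Phi> L where "finite \<Phi>" "L \<ge> 1"
    "\<And>f a b. f \<in> \<Phi> \<Longrightarrow> a \<in> A \<Longrightarrow> b \<in> A \<Longrightarrow> \<bar>f a - f b\<bar> \<le> L * \<rho> a b"
    "\<And>a b. a \<in> A \<Longrightarrow> b \<in> A \<Longrightarrow> \<exists>f\<in>\<Phi>. \<rho> a b \<le> L * \<bar>f a - f b\<bar>"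
proof -
  obtain \<Phi> L where c: "bilip_coords \<rho> A \<Phi> L"
    using assms unfolding bilip_embeddable_def by (elim exE)
  show thesis by (rule that[of \<Phi> L]) (use c in \<open>simp_all add: bilip_coords_def\<close>)
qed

lemma bilip_embeddable_empty: "bilip_embeddable \<rho> {}"
  unfolding bilip_embeddable_def bilip_coords_def by (intro exI[of _ "{}"] exI[of _ 1]) auto

lemma bilip_embeddable_pullback:
  assumes "bilip_embeddable \<sigma> B" "T ` A \<subseteq> B" "C \<ge> 1"
    and le: "\<And>a b. a \<in> A \<Longrightarrow> b \<in> A \<Longrightarrow> \<rho> a b \<le> C * \<sigma> (T a) (T b)"
    and ge: "\<And>a b. a \<in> A \<Longrightarrow> b \<in> A \<Longrightarrow> \<sigma> (T a) (T b) \<le> C * \<rho> a b"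
  shows "bilip_embeddable \<rho> A"
proof -
  obtain \<Phi> L where \<Phi>: "finite \<Phi>" "L \<ge> 1"
    "\<And>f a b. f \<in> \<Phi> \<Longrightarrow> a \<in> B \<Longrightarrow> b \<in> B \<Longrightarrow> \<bar>f a - f b\<bar> \<le> L * \<sigma> a b"
    "\<And>a b. a \<in> B \<Longrightarrow> b \<in> B \<Longrightarrow> \<exists>f\<in>\<Phi>. \<sigma> a b \<le> L * \<bar>f a - f b\<bar>"
    using bilip_embeddableE[OF assms(1)] by metis
  have "bilip_coords \<rho> A ((\<lambda>f. f \<circ> T) ` \<Phi>) (C * L)"
    unfolding bilip_coords_def
  proof (intro conjI ballI)
    show "1 \<le> C * L" using \<open>C \<ge> 1\<close> \<open>L \<ge> 1\<close> mult_mono[of 1 C 1 L] by simp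
    fix g a b assume g: "g \<in> (\<lambda>f. f \<circ> T) ` \<Phi>" and ab: "a \<in> A" "b \<in> A"
    then obtain f where f: "f \<in> \<Phi>" "g = f \<circ> T" by blast
    have "\<bar>f (T a) - f (T b)\<bar> \<le> L * \<sigma> (T a) (T b)"
      using f ab assms(2) by (intro \<Phi>(3)) auto
    also have "\<dots> \<le> L * (C * \<rho> a b)" using ge[OF ab] \<Phi>(2) by (intro mult_left_mono) auto
    finally show "\<bar>g a - g b\<bar> \<le> C * L * \<rho> a b" by (simp add: f mult_ac)
  next
    fix a b assume ab: "a \<in> A" "b \<in> A"
    then obtain f where f: "f \<in> \<Phi>" "\<sigma> (T a) (T b) \<le> L * \<bar>f (T a) - f (T b)\<bar>"
      using \<Phi>(4)[of "T a" "T b"] assms(2) by blast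
    have "\<rho> a b \<le> C * \<sigma> (T a) (T b)" by (rule le[OF ab])
    also have "\<dots> \<le> C * (L * \<bar>f (T a) - f (T b)\<bar>)" using f(2) \<open>C \<ge> 1\<close> by (intro mult_left_mono) auto
    finally show "\<exists>g\<in>(\<lambda>f. f \<circ> T) ` \<Phi>. \<rho> a b \<le> C * L * \<bar>g a - g b\<bar>"
      using f(1) by (intro bexI[of _ "f \<circ> T"]) (auto simp: mult_ac)
  qed (use \<Phi>(1) in auto)
  then show ?thesis unfolding bilip_embeddable_def by blast
qed

lemma bilip_embeddable_subset:
  assumes "bilip_embeddable \<rho> B" "A \<subseteq> B"
  shows "bilip_embeddable \<rho> A"
  by (rule bilip_embeddable_pullback[OF assms(1), of id A 1]) (use assms(2) in auto)

section \<open>Lipschitz extension and finite unions\<close>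

locale pseudometric =
  fixes \<rho> :: "'a \<Rightarrow> 'a \<Rightarrow> real"
  assumes self [simp]: "\<rho> x x = 0"
    and sym: "\<rho> x y = \<rho> y x"
    and triangle: "\<rho> x z \<le> \<rho> x y + \<rho> y z"
begin

lemma nonneg [simp]: "0 \<le> \<rho> x y"
  using triangle[of x x y] sym[of x y] by simp

text \<open>For an \<open>L\<close>-Lipschitz \<open>f\<close> on a nonempty \<open>A\<close> this
  is the largest \<open>L\<close>-Lipschitz extension. With \<open>L = 1\<close> and
  \<open>f = 0\<close> it is the distance to \<open>A\<close>, the extra coordinate of the union
  lemma.\<close>

definition mcshane :: "real \<Rightarrow> 'a set \<Rightarrow> ('a \<Rightarrow> real) \<Rightarrow> 'a \<Rightarrow> real" where
  "mcshane L A f x = (INF a\<in>A. f a + L * \<rho> x a)"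

context
  fixes L A f
  assumes L: "0 \<le> L" and ne: "A \<noteq> {}"
    and lip: "\<And>a b. a \<in> A \<Longrightarrow> b \<in> A \<Longrightarrow> \<bar>f a - f b\<bar> \<le> L * \<rho> a b"
begin

text \<open>An infimum of reals is meaningful only with a lower bound; one point \<open>a0\<close>
  of \<open>A\<close> supplies it through the Lipschitz condition and the triangle
  inequality.\<close>

lemma mcshane_bdd: "bdd_below ((\<lambda>a. f a + L * \<rho> x a) ` A)"
proof -
  obtain a0 where a0: "a0 \<in> A" using ne by blast
  show ?thesis
  proof (rule bdd_belowI2[of _ "f a0 - L * \<rho> a0 x"])
    fix a assume a: "a \<in> A"
    have "L * \<rho> a0 a \<le> L * (\<rho> a0 x + \<rho> x a)" using L triangle by (intro mult_left_mono)
    then show "f a0 - L * \<rho> a0 x \<le> f a + L * \<rho> x a"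
      using lip[OF a0 a] by (simp add: algebra_simps)
  qed
qed

lemma mcshane_le: "a \<in> A \<Longrightarrow> mcshane L A f x \<le> f a + L * \<rho> x a"
  unfolding mcshane_def by (rule cINF_lower[OF mcshane_bdd])

lemma mcshane_eq: "a \<in> A \<Longrightarrow> mcshane L A f a = f a"
proof (rule antisym)
  assume a: "a \<in> A"
  show "mcshane L A f a \<le> f a" using mcshane_le[OF a, of a] by simp
  show "f a \<le> mcshane L A f a" unfolding mcshane_def
  proof (rule cINF_greatest[OF ne])
    fix b assume "b \<in> A" then show "f a \<le> f b + L * \<rho> a b" using lip[OF a, of b] by simp
  qed
qed

lemma mcshane_lipschitz: "\<bar>mcshane L A f x - mcshane L A f y\<bar> \<le> L * \<rho> x y"
proof -
  have *: "mcshane L A f x - L * \<rho> x y \<le> mcshane L A f y" for x y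
    unfolding mcshane_def[of _ _ _ y]
  proof (rule cINF_greatest[OF ne])
    fix a assume a: "a \<in> A"
    have "L * \<rho> x a \<le> L * (\<rho> x y + \<rho> y a)" using L triangle by (intro mult_left_mono)
    then show "mcshane L A f x - L * \<rho> x y \<le> f a + L * \<rho> y a"
      using mcshane_le[OF a, of x] by (simp add: algebra_simps)
  qed
  show ?thesis using *[of x y] *[of y x] sym[of x y] by simp
qed

end

text \<open>The upper bounds become global while the lower bounds stay on \<open>A\<close>. Global
  upper bounds let coordinates of one piece be evaluated on another.\<close>

lemma bilip_embeddable_extend:
  assumes "bilip_embeddable \<rho> A" "A \<noteq> {}"
  obtains \<Phi> L where "finite \<Phi>" "L \<ge> 1"
    "\<And>f x y. f \<in> \<Phi> \<Longrightarrow> \<bar>f x - f y\<bar> \<le> L * \<rho> x y"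
    "\<And>a b. a \<in> A \<Longrightarrow> b \<in> A \<Longrightarrow> \<exists>f\<in>\<Phi>. \<rho> a b \<le> L * \<bar>f a - f b\<bar>"
proof -
  obtain \<Phi> L where \<Phi>: "finite \<Phi>" "L \<ge> 1"
    "\<And>f a b. f \<in> \<Phi> \<Longrightarrow> a \<in> A \<Longrightarrow> b \<in> A \<Longrightarrow> \<bar>f a - f b\<bar> \<le> L * \<rho> a b"
    "\<And>a b. a \<in> A \<Longrightarrow> b \<in> A \<Longrightarrow> \<exists>f\<in>\<Phi>. \<rho> a b \<le> L * \<bar>f a - f b\<bar>"
    using bilip_embeddableE[OF assms(1)] by metis
  have L0: "0 \<le> L" using \<Phi>(2) by simp
  show thesis
  proof (rule that[of "mcshane L A ` \<Phi>" L])
    fix g x y assume "g \<in> mcshane L A ` \<Phi>"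
    then obtain f where f: "f \<in> \<Phi>" "g = mcshane L A f" by blast
    show "\<bar>g x - g y\<bar> \<le> L * \<rho> x y"
      using mcshane_lipschitz[OF L0 assms(2) \<Phi>(3)[OF f(1)]] by (simp add: f(2))
  next
    fix a b assume ab: "a \<in> A" "b \<in> A"
    then obtain f where f: "f \<in> \<Phi>" "\<rho> a b \<le> L * \<bar>f a - f b\<bar>" using \<Phi>(4) by blast
    then show "\<exists>f\<in>mcshane L A ` \<Phi>. \<rho> a b \<le> L * \<bar>f a - f b\<bar>"
      using mcshane_eq[OF L0 assms(2) \<Phi>(3)[OF f(1)]] ab by (intro bexI[of _ "mcshane L A f"]) auto
  qed (use \<Phi> in auto)
qed

text \<open>For \<open>a \<in> A\<close> and \<open>b \<in> B\<close>, either \<open>b\<close> is so close to some \<open>a' \<in> A\<close> that the coordinates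
  separating \<open>a\<close> from \<open>a'\<close> also separate \<open>a\<close> from \<open>b\<close>, or the distance to \<open>A\<close> does.\<close>
lemma bilip_embeddable_Un:
  assumes "bilip_embeddable \<rho> A" "bilip_embeddable \<rho> B"
  shows "bilip_embeddable \<rho> (A \<union> B)"
proof (cases "A = {} \<or> B = {}")
  case True then show ?thesis using assms by auto
next
  case False
  obtain \<Phi> L where \<Phi>: "finite \<Phi>" "L \<ge> 1"
    "\<And>f x y. f \<in> \<Phi> \<Longrightarrow> \<bar>f x - f y\<bar> \<le> L * \<rho> x y"
    "\<And>a b. a \<in> A \<Longrightarrow> b \<in> A \<Longrightarrow> \<exists>f\<in>\<Phi>. \<rho> a b \<le> L * \<bar>f a - f b\<bar>"
    using bilip_embeddable_extend[OF assms(1)] False by metis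
  obtain \<Psi> M where \<Psi>: "finite \<Psi>" "M \<ge> 1"
    "\<And>f x y. f \<in> \<Psi> \<Longrightarrow> \<bar>f x - f y\<bar> \<le> M * \<rho> x y"
    "\<And>a b. a \<in> B \<Longrightarrow> b \<in> B \<Longrightarrow> \<exists>f\<in>\<Psi>. \<rho> a b \<le> M * \<bar>f a - f b\<bar>"
    using bilip_embeddable_extend[OF assms(2)] False by metis
  define g where "g = mcshane 1 A (\<lambda>_. 0)"
  have A: "A \<noteq> {}" using False by simp
  have g_eq: "g a = 0" if "a \<in> A" for a
    unfolding g_def using mcshane_eq[of 1 A "\<lambda>_. 0" a] A that by simp
  have g_lip: "\<bar>g x - g y\<bar> \<le> \<rho> x y" for x y
    unfolding g_def using mcshane_lipschitz[of 1 A "\<lambda>_. 0" x y] A by simp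
  \<comment> \<open>A nearest point of \<open>A\<close> need not exist, but a strict bound on the
    infimum still yields a witness.\<close>
  have g_less: "\<exists>a\<in>A. \<rho> x a < r" if "g x < r" for x r
  proof -
    have "(INF a\<in>A. \<rho> x a) < r" using that by (simp add: g_def mcshane_def)
    then show ?thesis using cInf_lessD[of "\<rho> x ` A" r] A by auto
  qed
  let ?\<Omega> = "insert g (\<Phi> \<union> \<Psi>)"
  define C where "C = 4 * L\<^sup>2 + M"
  have LL: "L \<le> L\<^sup>2" using \<Phi>(2) by (simp add: power2_eq_square)
  have C: "L \<le> C" "M \<le> C" "1 \<le> C" "2 * L \<le> C" "4 * L\<^sup>2 \<le> C"
    using LL \<Phi>(2) \<Psi>(2) unfolding C_def by auto
  have weaken: "K * r \<le> C * r" if "K \<le> C" "0 \<le> r" for K r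
    using that by (intro mult_right_mono) auto
  \<comment> \<open>The threshold \<open>4 * L\<^sup>2\<close> makes the error of replacing
    \<open>b\<close> by \<open>a'\<close>, at most \<open>2 * L\<^sup>2 * \<rho> b a'\<close>, no
    more than half of \<open>\<rho> a b\<close>; absorbing it leaves the constant
    \<open>2 * L\<close>.\<close>
  have cross: "\<exists>f\<in>?\<Omega>. \<rho> a b \<le> C * \<bar>f a - f b\<bar>" if ab: "a \<in> A" for a b
  proof (cases "\<rho> a b \<le> 4 * L\<^sup>2 * g b")
    case True
    have "4 * L\<^sup>2 * g b \<le> 4 * L\<^sup>2 * \<bar>g a - g b\<bar>" using g_eq[OF ab] by (intro mult_left_mono) auto
    with True have "\<rho> a b \<le> 4 * L\<^sup>2 * \<bar>g a - g b\<bar>" by linarith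
    also have "\<dots> \<le> C * \<bar>g a - g b\<bar>" by (rule weaken) (use C in auto)
    finally show ?thesis by blast
  next
    case False
    have "0 < L\<^sup>2" using \<Phi>(2) by (intro zero_less_power) linarith
    then have "g b < \<rho> a b / (4 * L\<^sup>2)" using False by (simp add: field_simps)
    then obtain a' where a': "a' \<in> A" "\<rho> b a' < \<rho> a b / (4 * L\<^sup>2)" using g_less by blast
    then have close: "4 * L\<^sup>2 * \<rho> b a' \<le> \<rho> a b" using \<open>0 < L\<^sup>2\<close> by (simp add: field_simps)
    obtain f where f: "f \<in> \<Phi>" "\<rho> a a' \<le> L * \<bar>f a - f a'\<bar>" using \<Phi>(4)[OF ab a'(1)] by blast
    have "\<bar>f a - f a'\<bar> \<le> \<bar>f a - f b\<bar> + L * \<rho> b a'"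
      using \<Phi>(3)[OF f(1), of b a'] by linarith
    then have "L * \<bar>f a - f a'\<bar> \<le> L * (\<bar>f a - f b\<bar> + L * \<rho> b a')"
      using \<Phi>(2) by (intro mult_left_mono) auto
    then have 1: "\<rho> a a' \<le> L * \<bar>f a - f b\<bar> + L\<^sup>2 * \<rho> b a'"
      using f(2) by (simp add: algebra_simps power2_eq_square)
    have "1 * \<rho> b a' \<le> L\<^sup>2 * \<rho> b a'" using LL \<Phi>(2) by (intro mult_right_mono) auto
    then have "\<rho> a b \<le> 2 * L * \<bar>f a - f b\<bar>"
      using 1 triangle[of a b a'] sym[of a' b] close by linarith
    also have "\<dots> \<le> C * \<bar>f a - f b\<bar>" by (rule weaken) (use C in auto)
    finally show ?thesis using f(1) by blast
  qed
  have "bilip_coords \<rho> (A \<union> B) ?\<Omega> C"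
    unfolding bilip_coords_def
  proof (intro conjI ballI)
    fix f x y assume "f \<in> ?\<Omega>"
    then consider "f = g" | "f \<in> \<Phi>" | "f \<in> \<Psi>" by blast
    then show "\<bar>f x - f y\<bar> \<le> C * \<rho> x y"
    proof cases
      case 1 then show ?thesis using g_lip[of x y] weaken[of 1 "\<rho> x y"] C by simp
    next
      case 2 then show ?thesis using \<Phi>(3)[of f x y] weaken[of L "\<rho> x y"] C by simp
    next
      case 3 then show ?thesis using \<Psi>(3)[of f x y] weaken[of M "\<rho> x y"] C by simp
    qed
  next
    fix a b assume "a \<in> A \<union> B" "b \<in> A \<union> B"
    then consider "a \<in> A" | "b \<in> A" | "a \<in> B" "b \<in> B" by blast
    then show "\<exists>f\<in>?\<Omega>. \<rho> a b \<le> C * \<bar>f a - f b\<bar>"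
    proof cases
      case 1 then show ?thesis by (rule cross)
    next
      case 2 then show ?thesis using cross[of b a] by (simp add: sym[of b a] abs_minus_commute)
    next
      case 3
      then obtain f where f: "f \<in> \<Psi>" "\<rho> a b \<le> M * \<bar>f a - f b\<bar>" using \<Psi>(4) by blast
      then have "\<rho> a b \<le> C * \<bar>f a - f b\<bar>"
        using weaken[OF C(2) abs_ge_zero[of "f a - f b"]] by linarith
      then show ?thesis using f(1) by blast
    qed
  qed (use \<Phi> \<Psi> C in auto)
  then show ?thesis unfolding bilip_embeddable_def by blast
qed

lemma bilip_embeddable_UN:
  "finite I \<Longrightarrow> (\<And>i. i \<in> I \<Longrightarrow> bilip_embeddable \<rho> (A i)) \<Longrightarrow> bilip_embeddable \<rho> (\<Union>i\<in>I. A i)"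
proof (induction I rule: finite_induct)
  case empty then show ?case by (simp add: bilip_embeddable_empty)
next
  case (insert x F) then show ?case by (auto intro: bilip_embeddable_Un)
qed

end

section \<open>The snowflake of an interval\<close>

text \<open>A Weierstrass-type series of Hoelder exponent 1/2: frequencies grow by 64, amplitudes
  shrink by 8, the square root of 64. The ratio is large enough for one term to outweigh all the
  others.\<close>

definition lacunary :: "real \<Rightarrow> real \<Rightarrow> complex" where
  "lacunary c t = (\<Sum>i. (1/8)^i *\<^sub>R cis (c * 64^i * t))"

lemma norm_cis_diff: "cmod (cis a - cis b) = 2 * \<bar>sin ((a - b) / 2)\<bar>"
proof -
  have "cis a - cis b = cis b * (cis (a - b) - 1)" by (simp add: algebra_simps cis_mult)
  then have "cmod (cis a - cis b) = cmod (cis (a - b) - 1)" by (simp add: norm_mult)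
  then show ?thesis using dist_exp_i_1[of "a - b"] by (simp add: cis_conv_exp)
qed

lemma norm_cis_diff_le: "cmod (cis a - cis b) \<le> \<bar>a - b\<bar>"
  using abs_sin_x_le_abs_x[of "(a - b) / 2"] by (simp add: norm_cis_diff)

text \<open>Base frequency \<open>pi / 3\<close> carries the scale window from 1 to 2 onto this
  window of angles, where the chord stays at least as long as at angle
  \<open>pi / 3\<close>.\<close>

lemma norm_cis_diff_ge:
  assumes "pi / 3 \<le> \<bar>a - b\<bar>" "\<bar>a - b\<bar> \<le> 2 * pi / 3"
  shows "1 \<le> cmod (cis a - cis b)"
proof -
  define x where "x = \<bar>a - b\<bar> / 2"
  have "pi / 6 \<le> x" "x \<le> pi / 3" using assms by (auto simp: x_def)
  then have "sin (pi / 6) \<le> sin x"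
    using pi_gt_zero by (intro sin_monotone_2pi_le) auto
  moreover have "\<bar>sin ((a - b) / 2)\<bar> \<ge> sin (\<bar>a - b\<bar> / 2)"
    by (cases "a - b \<ge> 0") (auto simp: minus_divide_left[symmetric] simp del: minus_diff_eq)
  ultimately show ?thesis by (simp add: norm_cis_diff sin_30 x_def)
qed

text \<open>Terms before \<open>n\<close> are bounded by the Lipschitz constant of
  \<open>cis\<close>, giving a geometric sum of ratio 64/8 = 8; terms after \<open>n\<close> are
  bounded by twice their amplitude, of ratio 1/8. Both sums produce the denominator 7.\<close>

lemma lacunary_split:
  fixes c s t :: real and n :: nat
  defines "g \<equiv> \<lambda>i. (1/8)^i *\<^sub>R (cis (c * 64^i * s) - cis (c * 64^i * t))"
  assumes c: "0 \<le> c"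
  shows "cmod (lacunary c s - lacunary c t - g n) \<le> c * \<bar>s - t\<bar> * 8^n / 7 + 2/7 * (1/8)^n"
proof -
  have geo: "summable (\<lambda>i. (1/8)^i :: real)" by (simp add: summable_geometric)
  have sm: "summable (\<lambda>i. (1/8)^i *\<^sub>R cis (c * 64^i * x))" for x
    by (rule summable_comparison_test'[OF geo, of 0]) simp
  have g_sums: "summable g" "lacunary c s - lacunary c t = suminf g"
    using summable_diff[OF sm sm] suminf_diff[OF sm sm, of s t]
    unfolding lacunary_def g_def by (auto simp: scaleR_diff_right)
  have g2: "cmod (g i) \<le> 2 * (1/8)^i" for i
    using norm_triangle_ineq4[of "cis (c * 64^i * s)" "cis (c * 64^i * t)"] by (simp add: g_def)
  have g1: "cmod (g i) \<le> c * \<bar>s - t\<bar> * 8^i" for i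
  proof -
    have "cmod (g i) \<le> (1/8)^i * \<bar>c * 64^i * s - c * 64^i * t\<bar>"
      unfolding g_def norm_scaleR using norm_cis_diff_le by (auto intro!: mult_mono)
    also have "\<bar>c * 64^i * s - c * 64^i * t\<bar> = c * 64^i * \<bar>s - t\<bar>"
      using c by (simp add: abs_mult flip: right_diff_distrib)
    also have "(64::real)^i = 8^i * 8^i" by (simp flip: power_mult_distrib)
    finally show ?thesis by (simp add: power_divide mult_ac)
  qed
  have "suminf g = (\<Sum>i. g (i + Suc n)) + (\<Sum>i<Suc n. g i)"
    by (rule suminf_split_initial_segment[OF g_sums(1)])
  then have eq: "lacunary c s - lacunary c t - g n = (\<Sum>i<n. g i) + (\<Sum>i. g (i + Suc n))"
    using g_sums(2) by simp
  have "cmod (\<Sum>i<n. g i) \<le> (\<Sum>i<n. c * \<bar>s - t\<bar> * 8^i)" by (intro sum_norm_le g1)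
  also have "\<dots> = c * \<bar>s - t\<bar> * ((8^n - 1) / 7)"
    by (simp add: sum_distrib_left[symmetric] geometric_sum)
  also have "\<dots> \<le> c * \<bar>s - t\<bar> * (8^n / 7)" using c by (intro mult_left_mono) auto
  finally have low: "cmod (\<Sum>i<n. g i) \<le> c * \<bar>s - t\<bar> * 8^n / 7" by simp
  have tail: "(\<lambda>i. 2 * (1/8) ^ Suc n * (1/8)^i) sums (2 * (1/8) ^ Suc n * (1 / (1 - 1/8 :: real)))"
    by (intro sums_mult geometric_sums) simp
  have "cmod (g (i + Suc n)) \<le> 2 * (1/8) ^ Suc n * (1/8)^i" for i
    using g2[of "i + Suc n"] by (simp add: power_add mult_ac)
  then have "cmod (\<Sum>i. g (i + Suc n)) \<le> (\<Sum>i. 2 * (1/8) ^ Suc n * (1/8)^i)"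
    by (rule norm_suminf_le[OF _ sums_summable[OF tail]])
  also have "\<dots> = 2/7 * (1/8)^n" unfolding sums_unique[OF tail, symmetric] by simp
  finally show ?thesis unfolding eq using low norm_triangle_ineq[of "\<Sum>i<n. g i"] by (smt (verit))
qed

text \<open>The least exponent \<open>N\<close> with \<open>1 \<le> 2^N * d\<close> is written as
  \<open>6 * n + j\<close>, since 64 is the sixth power of 2. Minimality gives the upper bound,
  except for \<open>N = 0\<close>, where it is the assumption \<open>d \<le> 2\<close>.\<close>

lemma ex_dyadic_scale:
  fixes d :: real
  assumes "0 < d" "d \<le> 2"
  shows "\<exists>n j. j < 6 \<and> 1 \<le> 2^j * 64^n * d \<and> 2^j * 64^n * d \<le> 2"
proof -
  have "\<exists>N. 1 / d < 2 ^ N" by (rule real_arch_pow) simp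
  then have ex: "\<exists>N. 1 \<le> 2^N * d" using assms by (auto simp: field_simps intro: less_imp_le)
  define N where "N = (LEAST N. 1 \<le> 2^N * d)"
  have N1: "1 \<le> 2^N * d" unfolding N_def using ex by (rule LeastI_ex)
  have N2: "2^N * d \<le> 2"
  proof (cases N)
    case 0 then show ?thesis using assms by simp
  next
    case (Suc m)
    then have "\<not> 1 \<le> 2^m * d" using not_less_Least[of m "\<lambda>N. 1 \<le> 2^N * d"] N_def by auto
    then show ?thesis using Suc by simp
  qed
  have "(2::real)^N = 2^(N mod 6 + 6 * (N div 6))" by simp
  also have "\<dots> = 2^(N mod 6) * 64^(N div 6)" unfolding power_add power_mult by simp
  finally show ?thesis using N1 N2
    by (intro exI[of _ "N div 6"] exI[of _ "N mod 6"]) auto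
qed

text \<open>At the scale \<open>2^j * 64^n * \<bar>s - t\<bar> \<in> {1..2}\<close>, the \<open>n\<close>-th term of the series with base frequency
  \<open>2^j\<close> moves by at least \<open>8^-n\<close> and dominates the sum of all others; six values of \<open>j\<close> cover
  all scales between consecutive powers of 64.\<close>
lemma bilip_embeddable_snowflake: "bilip_embeddable (\<lambda>s t. sqrt \<bar>s - t\<bar>) {-1..1::real}"
proof -
  define F where "F j = lacunary (2^j * (pi / 3))" for j :: nat
  have pi4: "pi / 3 \<le> 1.05" using pi_approx by simp
  \<comment> \<open>With \<open>e\<close> the amplitude at the critical scale, the upper bound is 12
    \<open>e\<close> (10 from the other terms, 2 from the critical one) and
    \<open>e \<le> 6 * sqrt d\<close>, giving 72. Below, at least 2/5 of \<open>e\<close> survives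
    and \<open>sqrt d \<le> 3/2 * e\<close>, giving 15/4, rounded to 4.\<close>
  have main: "(\<forall>j<6. cmod (F j s - F j t) \<le> 72 * sqrt \<bar>s - t\<bar>) \<and>
      (\<exists>j<6. sqrt \<bar>s - t\<bar> \<le> 4 * cmod (F j s - F j t))"
    if st: "s \<in> {-1..1}" "t \<in> {-1..1}" for s t
  proof (cases "s = t")
    case True then show ?thesis by (auto intro: exI[of _ 0])
  next
    case False
    define d where "d = \<bar>s - t\<bar>"
    have d: "0 < d" "d \<le> 2" using st False by (auto simp: d_def)
    obtain n j where nj: "j < 6" "1 \<le> 2^j * 64^n * d" "2^j * 64^n * d \<le> 2"
      using ex_dyadic_scale[OF d] by blast
    define e :: real where "e = (1/8)^n"
    have e: "0 < e" "e * 8^n = 1" by (auto simp: e_def power_divide)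
    have "(64::real)^n = 8^n * 8^n" by (simp flip: power_mult_distrib)
    then have "64^n * e\<^sup>2 = (e * 8^n) * (e * 8^n)" by (simp add: power2_eq_square mult_ac)
    then have ee: "64^n * e\<^sup>2 = 1" unfolding e(2) by simp
    have d8: "64^n * d * e = d * 8^n" using e(2) \<open>64^n = 8^n * 8^n\<close> by (simp add: algebra_simps)
    have "(2::real)^j \<le> 2^5" using nj(1) by (intro power_increasing) auto
    then have j32: "(2::real)^j \<le> 32" by simp
    have "1 * (64^n * d) \<le> 2^j * (64^n * d)" using d by (intro mult_right_mono) auto
    also have "\<dots> \<le> 2" using nj(3) by (simp add: mult.assoc)
    finally have u: "64^n * d \<le> 2" by simp
    have "1 \<le> 2^j * (64^n * d)" using nj(2) by (simp add: mult.assoc)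
    also have "\<dots> \<le> 32 * (64^n * d)" using d j32 by (intro mult_right_mono) auto
    finally have l: "1 \<le> 32 * (64^n * d)" .
    have dU: "64^n * d * e\<^sup>2 = d" using arg_cong[OF ee, of "\<lambda>x. d * x"] by (simp add: mult_ac)
    have "64^n * d * e\<^sup>2 \<le> 2 * e\<^sup>2" by (intro mult_right_mono u) simp
    then have "d \<le> 2 * e\<^sup>2" unfolding dU .
    moreover have "1 * e\<^sup>2 \<le> 32 * (64^n * d) * e\<^sup>2" by (intro mult_right_mono l) simp
    then have "e\<^sup>2 \<le> 32 * d" unfolding mult.assoc[of 32] dU by simp
    ultimately have "d \<le> (3/2 * e)\<^sup>2" "e\<^sup>2 \<le> 36 * d" using d by (auto simp: power_mult_distrib power_divide)
    then have "sqrt d \<le> sqrt ((3/2 * e)\<^sup>2)" "sqrt (e\<^sup>2) \<le> sqrt (36 * d)"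
      by (simp_all only: real_sqrt_le_iff)
    then have "sqrt d \<le> 3/2 * e" "e \<le> sqrt (36 * d)" using e by auto
    then have sq: "sqrt d \<le> 3/2 * e" "e \<le> 6 * sqrt d" by (auto simp: real_sqrt_mult)
    \<comment> \<open>All six series are split at the same \<open>n\<close>, although only frequency
      \<open>j\<close> is tuned to this scale; the mismatch costs at most the factor 32 in
      \<open>?c\<close>.\<close>
    have "cmod (F i s - F i t) \<le> 72 * sqrt d" if i: "i < 6" for i
    proof -
      let ?c = "2^i * (pi / 3)"
      let ?g = "(1/8)^n *\<^sub>R (cis (?c * 64^n * s) - cis (?c * 64^n * t))"
      have "(2::real)^i \<le> 2^5" using i by (intro power_increasing) auto
      then have "?c \<le> 32 * 1.05" using pi4 by (intro mult_mono) auto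
      then have c: "?c \<le> 34" by simp
      have "?c * d * 8^n = ?c * (64^n * d) * e"
        using arg_cong[OF d8, of "\<lambda>x. ?c * x"] by (simp only: mult_ac)
      also have "\<dots> \<le> 34 * 2 * e" using c u e d by (intro mult_mono) auto
      finally have "?c * d * 8^n \<le> 68 * e" by simp
      then have "cmod (F i s - F i t - ?g) \<le> 68 * e / 7 + 2/7 * e"
        using lacunary_split[of ?c s t n] by (auto simp: F_def d_def e_def)
      moreover have "cmod ?g \<le> e * 2"
        unfolding norm_scaleR e_def
        using norm_triangle_ineq4[of "cis (?c * 64^n * s)" "cis (?c * 64^n * t)"] by simp
      ultimately have "cmod (F i s - F i t) \<le> 12 * e"
        using norm_triangle_sub[of "F i s - F i t" ?g] by simp
      then show ?thesis using sq by simp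
    qed
    moreover have "sqrt d \<le> 4 * cmod (F j s - F j t)"
    proof -
      let ?c = "2^j * (pi / 3)"
      let ?g = "(1/8)^n *\<^sub>R (cis (?c * 64^n * s) - cis (?c * 64^n * t))"
      have "\<bar>?c * 64^n * s - ?c * 64^n * t\<bar> = \<bar>(?c * 64^n) * (s - t)\<bar>"
        by (simp only: right_diff_distrib)
      also have "\<dots> = ?c * 64^n * d" unfolding abs_mult by (simp add: d_def)
      finally have arg: "\<bar>?c * 64^n * s - ?c * 64^n * t\<bar> = (2^j * 64^n * d) * (pi / 3)" by simp
      have "1 * (pi / 3) \<le> (2^j * 64^n * d) * (pi / 3)" by (intro mult_right_mono nj) simp
      moreover have up: "(2^j * 64^n * d) * (pi / 3) \<le> 2 * (pi / 3)" by (intro mult_right_mono nj) simp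
      ultimately have "1 \<le> cmod (cis (?c * 64^n * s) - cis (?c * 64^n * t))"
        using arg by (intro norm_cis_diff_ge) auto
      then have g: "e \<le> cmod ?g" using e unfolding norm_scaleR e_def by simp
      have "?c * d * 8^n = ((2^j * 64^n * d) * (pi / 3)) * e"
        using arg_cong[OF d8, of "\<lambda>x. ?c * x"] by (simp only: mult_ac)
      also have "\<dots> \<le> 2.1 * e"
      proof (rule mult_right_mono)
        have "2 * (pi / 3) \<le> 2.1" using pi4 by simp
        with up show "(2^j * 64^n * d) * (pi / 3) \<le> 2.1" by (rule order_trans)
      qed (use e in simp)
      finally have "cmod (F j s - F j t - ?g) \<le> 2.1 * e / 7 + 2/7 * e"
        using lacunary_split[of ?c s t n] by (auto simp: F_def d_def e_def)
      then have "2/5 * e \<le> cmod (F j s - F j t)"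
        using g norm_triangle_sub[of ?g "F j s - F j t"] e by (simp add: norm_minus_commute)
      then show ?thesis using sq by simp
    qed
    ultimately show ?thesis using nj(1) by (auto simp: d_def)
  qed
  let ?\<Phi> = "(\<lambda>j t. Re (F j t)) ` {..<6} \<union> (\<lambda>j t. Im (F j t)) ` {..<6}"
  have "bilip_coords (\<lambda>s t. sqrt \<bar>s - t\<bar>) {-1..1} ?\<Phi> 72"
    unfolding bilip_coords_def
  proof (intro conjI ballI)
    fix f s t assume f: "f \<in> ?\<Phi>" and st: "s \<in> {-1..1::real}" "t \<in> {-1..1::real}"
    then obtain j where j: "j < 6" "f = (\<lambda>t. Re (F j t)) \<or> f = (\<lambda>t. Im (F j t))" by auto
    then have "\<bar>f s - f t\<bar> \<le> cmod (F j s - F j t)"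
      using abs_Re_le_cmod[of "F j s - F j t"] abs_Im_le_cmod[of "F j s - F j t"] by auto
    then show "\<bar>f s - f t\<bar> \<le> 72 * sqrt \<bar>s - t\<bar>" using main[OF st] j(1) by fastforce
  next
    fix s t assume st: "s \<in> {-1..1::real}" "t \<in> {-1..1::real}"
    then obtain j where j: "j < 6" "sqrt \<bar>s - t\<bar> \<le> 4 * cmod (F j s - F j t)" using main by blast
    let ?z = "F j s - F j t"
    have "cmod ?z \<le> \<bar>Re ?z\<bar> + \<bar>Im ?z\<bar>" by (rule cmod_le)
    then consider "sqrt \<bar>s - t\<bar> \<le> 72 * \<bar>Re ?z\<bar>" | "sqrt \<bar>s - t\<bar> \<le> 72 * \<bar>Im ?z\<bar>"
      using j(2) by linarith
    then show "\<exists>f\<in>?\<Phi>. sqrt \<bar>s - t\<bar> \<le> 72 * \<bar>f s - f t\<bar>"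
      using j(1) by cases auto
  qed auto
  then show ?thesis unfolding bilip_embeddable_def by blast
qed

section \<open>Model spaces: strip and cone\<close>

lemma bilip_embeddable_strip:
  "bilip_embeddable (\<lambda>p q. \<bar>fst p - fst q\<bar> + sqrt \<bar>snd p - snd q\<bar>) (UNIV \<times> {-R..R::real})"
proof -
  obtain \<Phi> L where \<Phi>: "finite \<Phi>" "L \<ge> 1"
    "\<And>f s t. f \<in> \<Phi> \<Longrightarrow> s \<in> {-1..1} \<Longrightarrow> t \<in> {-1..1} \<Longrightarrow> \<bar>f s - f t\<bar> \<le> L * sqrt \<bar>s - t\<bar>"
    "\<And>s t. s \<in> {-1..1::real} \<Longrightarrow> t \<in> {-1..1} \<Longrightarrow> \<exists>f\<in>\<Phi>. sqrt \<bar>s - t\<bar> \<le> L * \<bar>f s - f t\<bar>"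
    using bilip_embeddableE[OF bilip_embeddable_snowflake] by metis
  \<comment> \<open>Taking the maximum with 1 makes the rescaling legitimate for every
    \<open>R\<close> and ensures \<open>sqrt S \<ge> 1\<close>, so that rescaling does not enlarge
    the snowflake distance.\<close>
  define S where "S = max R 1"
  have S: "S \<ge> 1" "R \<le> S" by (auto simp: S_def)
  have q: "sqrt S \<ge> 1" using S by simp
  have scale: "sqrt \<bar>u - v\<bar> = sqrt S * sqrt \<bar>u / S - v / S\<bar>" for u v
    using S by (simp add: real_sqrt_mult[symmetric] abs_mult diff_divide_distrib[symmetric])
  have mem: "u / S \<in> {-1..1}" if "u \<in> {-R..R}" for u using that S by (auto simp: field_simps)
  define C where "C = 2 * sqrt S * L"
  have C1: "2 * L \<le> C" using mult_right_mono[OF q, of "2 * L"] \<Phi>(2) by (simp add: C_def)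
  then have C: "2 \<le> C" "L \<le> C" using \<Phi>(2) by auto
  let ?\<Phi> = "insert fst ((\<lambda>f p. f (snd p / S)) ` \<Phi>)"
  have "bilip_coords (\<lambda>p q. \<bar>fst p - fst q\<bar> + sqrt \<bar>snd p - snd q\<bar>) (UNIV \<times> {-R..R}) ?\<Phi> C"
    unfolding bilip_coords_def
  proof (intro conjI ballI)
    fix g and a b :: "real \<times> real"
    assume g: "g \<in> ?\<Phi>" and ab: "a \<in> UNIV \<times> {-R..R}" "b \<in> UNIV \<times> {-R..R}"
    let ?r = "\<bar>fst a - fst b\<bar> + sqrt \<bar>snd a - snd b\<bar>"
    have r: "0 \<le> ?r" by simp
    from g consider "g = fst" | f where "f \<in> \<Phi>" "g = (\<lambda>p. f (snd p / S))" by auto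
    then show "\<bar>g a - g b\<bar> \<le> C * ?r"
    proof cases
      case 1
      have "\<bar>g a - g b\<bar> \<le> 1 * ?r" by (simp add: 1)
      also have "\<dots> \<le> C * ?r" using C by (intro mult_right_mono r) auto
      finally show ?thesis .
    next
      case 2
      let ?x = "sqrt \<bar>snd a / S - snd b / S\<bar>"
      have "1 * ?x \<le> sqrt S * ?x" using q by (intro mult_right_mono) auto
      then have x: "?x \<le> ?r" by (simp add: scale[of "snd a" "snd b"])
      have "\<bar>g a - g b\<bar> \<le> L * ?x" unfolding 2 using ab by (intro \<Phi>(3) 2(1) mem) auto
      also have "\<dots> \<le> C * ?r" using C x \<Phi>(2) by (intro mult_mono) auto
      finally show ?thesis .
    qed
  next
    fix a b :: "real \<times> real" assume ab: "a \<in> UNIV \<times> {-R..R}" "b \<in> UNIV \<times> {-R..R}"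
    obtain f where f: "f \<in> \<Phi>"
      "sqrt \<bar>snd a / S - snd b / S\<bar> \<le> L * \<bar>f (snd a / S) - f (snd b / S)\<bar>"
      using \<Phi>(4)[of "snd a / S" "snd b / S"] mem ab by auto
    show "\<exists>g\<in>?\<Phi>. \<bar>fst a - fst b\<bar> + sqrt \<bar>snd a - snd b\<bar> \<le> C * \<bar>g a - g b\<bar>"
    proof (cases "sqrt \<bar>snd a - snd b\<bar> \<le> \<bar>fst a - fst b\<bar>")
      case True
      have "2 * \<bar>fst a - fst b\<bar> \<le> C * \<bar>fst a - fst b\<bar>" using C by (intro mult_right_mono) auto
      then show ?thesis using True by (intro bexI[of _ fst]) auto
    next
      case False
      have "sqrt \<bar>snd a - snd b\<bar> \<le> sqrt S * (L * \<bar>f (snd a / S) - f (snd b / S)\<bar>)"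
        unfolding scale[of "snd a" "snd b"] using f(2) S by (intro mult_left_mono) auto
      then show ?thesis using False f(1)
        by (intro bexI[of _ "\<lambda>p. f (snd p / S)"]) (auto simp: C_def)
    qed
  qed (use \<Phi> C in auto)
  then show ?thesis unfolding bilip_embeddable_def by blast
qed

text \<open>In polar-type coordinates \<open>(x, s)\<close> with \<open>s = y / x\<close>, the term \<open>\<bar>x y' - x' y\<bar>\<close> is
  \<open>\<bar>x x'\<bar> \<bar>s - s'\<bar>\<close>, so the sector is a cone over the snowflake of \<open>[-1, 1]\<close>, embedded by
  \<open>(x, x \<phi> s)\<close>. At the apex the junk value \<open>0 / 0 = 0\<close> is harmless.\<close>
lemma bilip_embeddable_sector:
  "bilip_embeddable
     (\<lambda>p q. \<bar>fst p - fst q\<bar> + \<bar>snd p - snd q\<bar> + sqrt \<bar>fst p * snd q - fst q * snd p\<bar>)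
     {p :: real \<times> real. \<bar>snd p\<bar> \<le> \<bar>fst p\<bar>}" (is "bilip_embeddable ?\<sigma> ?A")
proof -
  obtain \<Phi> L where \<Phi>: "finite \<Phi>" "L \<ge> 1"
    "\<And>f s t. f \<in> \<Phi> \<Longrightarrow> s \<in> {-1..1} \<Longrightarrow> t \<in> {-1..1} \<Longrightarrow> \<bar>f s - f t\<bar> \<le> L * sqrt \<bar>s - t\<bar>"
    "\<And>s t. s \<in> {-1..1::real} \<Longrightarrow> t \<in> {-1..1} \<Longrightarrow> \<exists>f\<in>\<Phi>. sqrt \<bar>s - t\<bar> \<le> L * \<bar>f s - f t\<bar>"
    using bilip_embeddableE[OF bilip_embeddable_snowflake] by metis
  \<comment> \<open>Subtracting \<open>f 0\<close> normalises the coordinate: \<open>f\<close>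
    itself comes with no bound, whereas the difference is at most \<open>L\<close> on the interval,
    so the radial change contributes only a multiple of \<open>\<bar>x - x'\<bar>\<close>.\<close>
  define h where "h f p = fst p * (f (snd p / fst p) - f 0)" for f :: "real \<Rightarrow> real" and p :: "real \<times> real"
  define C where "C = 10 * L\<^sup>2"
  have LL: "L \<le> L\<^sup>2" using \<Phi>(2) by (simp add: power2_eq_square)
  have C: "10 * L \<le> C" "2 * L \<le> C" "1 \<le> C" using \<Phi>(2) LL by (auto simp: C_def)
  have main: "(\<forall>f\<in>\<Phi>. \<bar>h f a - h f b\<bar> \<le> C * ?\<sigma> a b) \<and>
      (?\<sigma> a b \<le> C * \<bar>fst a - fst b\<bar> \<or> (\<exists>f\<in>\<Phi>. ?\<sigma> a b \<le> C * \<bar>h f a - h f b\<bar>))"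
    if ab: "a \<in> ?A" "b \<in> ?A" and le: "\<bar>fst b\<bar> \<le> \<bar>fst a\<bar>" for a b
  proof -
    define x s x' s' where "x = fst a" "s = snd a / fst a" "x' = fst b" "s' = snd b / fst b"
    note defs = this
    have y: "fst a = x" "fst b = x'" "snd a = x * s" "snd b = x' * s'"
      using ab by (auto simp: defs)
    have s: "s \<in> {-1..1}" "s' \<in> {-1..1}"
      using ab abs_le_iff by (auto simp: defs abs_le_iff divide_simps)
    \<comment> \<open>The metric is comparable to \<open>e + m * d\<close>, radial plus angular
      displacement; \<open>m\<close> is the smaller of the two radii because of \<open>le\<close>.
      The bounds \<open>sig_le\<close> and \<open>sig_ge\<close> make this precise.\<close>
    define d e m where "d = sqrt \<bar>s - s'\<bar>" "e = \<bar>x - x'\<bar>" "m = \<bar>x'\<bar>"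
    note dem = this
    have nn: "0 \<le> d" "0 \<le> e" "0 \<le> m" by (auto simp: dem)
    have dd: "\<bar>s - s'\<bar> = d\<^sup>2" by (simp add: dem)
    have "d\<^sup>2 \<le> 2\<^sup>2" using s dd[symmetric] by auto
    then have d2: "d \<le> 2" by (rule power2_le_imp_le) simp
    have xm: "\<bar>x\<bar> \<le> m + e" "m \<le> \<bar>x\<bar>" using le by (auto simp: dem y)
    have "\<bar>x * (x' * s') - x' * (x * s)\<bar> = \<bar>x\<bar> * m * d\<^sup>2"
    proof -
      have "x * (x' * s') - x' * (x * s) = x * x' * (s' - s)" by (simp add: algebra_simps)
      then show ?thesis by (simp add: abs_mult abs_minus_commute dem)
    qed
    then have sq: "sqrt \<bar>x * (x' * s') - x' * (x * s)\<bar> = sqrt (\<bar>x\<bar> * m) * d"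
      using nn by (simp add: real_sqrt_mult)
    have "sqrt (m\<^sup>2) \<le> sqrt (\<bar>x\<bar> * m)"
      using xm nn by (intro real_sqrt_le_mono) (auto simp: power2_eq_square intro: mult_right_mono)
    then have m_le: "m * d \<le> sqrt (\<bar>x\<bar> * m) * d" using nn by (intro mult_right_mono) auto
    have "\<bar>x\<bar> * m \<le> (m + e) * m" using xm nn by (intro mult_right_mono) auto
    also have "\<dots> \<le> (m + e)\<^sup>2" using nn by (simp add: power2_eq_square algebra_simps)
    finally have "sqrt (\<bar>x\<bar> * m) \<le> m + e" using nn by (intro real_le_lsqrt) auto
    then have "sqrt (\<bar>x\<bar> * m) * d \<le> (m + e) * d" using nn by (intro mult_right_mono) auto
    also have "\<dots> \<le> m * d + 2 * e" using mult_left_mono[OF d2 nn(2)] by (simp add: algebra_simps)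
    finally have le_m: "sqrt (\<bar>x\<bar> * m) * d \<le> m * d + 2 * e" .
    have "\<bar>x * s - x' * s'\<bar> \<le> \<bar>(x - x') * s\<bar> + \<bar>x' * (s - s')\<bar>" by (simp add: algebra_simps)
    also have "\<dots> = e * \<bar>s\<bar> + m * d\<^sup>2" by (simp add: abs_mult dem)
    also have "\<dots> \<le> e * 1 + m * (2 * d)"
      using s nn d2 by (intro add_mono mult_left_mono) (auto simp: power2_eq_square intro: mult_right_mono)
    finally have yd: "\<bar>x * s - x' * s'\<bar> \<le> e + 2 * (m * d)" by simp
    have sig: "?\<sigma> a b = e + \<bar>x * s - x' * s'\<bar> + sqrt (\<bar>x\<bar> * m) * d"
      unfolding y sq by (simp add: dem)
    have sig_le: "?\<sigma> a b \<le> 4 * e + 3 * (m * d)" using yd le_m unfolding sig by linarith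
    have sig_ge: "e + m * d \<le> ?\<sigma> a b" using m_le unfolding sig by simp
    have h: "h f a - h f b = (x - x') * (f s - f 0) + x' * (f s - f s')" for f
      by (simp add: h_def defs algebra_simps)
    have bnd: "\<bar>f s - f 0\<bar> \<le> 2 * L" if "f \<in> \<Phi>" for f
    proof -
      have "\<bar>f s - f 0\<bar> \<le> L * sqrt \<bar>s - 0\<bar>" using s by (intro \<Phi>(3) that) auto
      also have "\<dots> \<le> L * 1" using s \<Phi>(2) by (intro mult_left_mono) auto
      finally show ?thesis using \<Phi>(2) by simp
    qed
    have err: "\<bar>(x - x') * (f s - f 0)\<bar> \<le> 2 * L * e" if "f \<in> \<Phi>" for f
      using mult_left_mono[OF bnd[OF that] nn(2)] by (simp add: abs_mult dem mult_ac)
    have "\<bar>h f a - h f b\<bar> \<le> C * ?\<sigma> a b" if f: "f \<in> \<Phi>" for f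
    proof -
      have "\<bar>x' * (f s - f s')\<bar> \<le> m * (L * d)"
        unfolding abs_mult dem by (intro mult_left_mono \<Phi>(3) f s) auto
      then have "\<bar>h f a - h f b\<bar> \<le> 2 * L * e + L * (m * d)"
        unfolding h using err[OF f] by (simp add: mult_ac)
      also have "\<dots> \<le> 2 * L * (e + m * d)" using \<Phi>(2) nn by (simp add: distrib_left)
      also have "\<dots> \<le> C * ?\<sigma> a b" using C sig_ge \<Phi>(2) nn by (intro mult_mono) auto
      finally show ?thesis .
    qed
    moreover have "?\<sigma> a b \<le> C * \<bar>fst a - fst b\<bar> \<or> (\<exists>f\<in>\<Phi>. ?\<sigma> a b \<le> C * \<bar>h f a - h f b\<bar>)"
    proof -
      obtain f where f: "f \<in> \<Phi>" "d \<le> L * \<bar>f s - f s'\<bar>" using \<Phi>(4)[OF s] by (auto simp: dem)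
      have "m * d \<le> m * (L * \<bar>f s - f s'\<bar>)" using f(2) nn by (intro mult_left_mono)
      also have "\<dots> = L * \<bar>x' * (f s - f s')\<bar>" by (simp add: abs_mult dem)
      also have "\<dots> \<le> L * (\<bar>h f a - h f b\<bar> + L * e)"
      proof (rule mult_left_mono)
        have "\<bar>f s - f 0\<bar> \<le> L * sqrt \<bar>s - 0\<bar>" using s by (intro \<Phi>(3) f) auto
        also have "\<dots> \<le> L * 1" using s \<Phi>(2) by (intro mult_left_mono) auto
        finally have "\<bar>(x - x') * (f s - f 0)\<bar> \<le> L * e"
          using mult_left_mono[of "\<bar>f s - f 0\<bar>" L e] nn by (simp add: abs_mult dem mult_ac)
        then show "\<bar>x' * (f s - f s')\<bar> \<le> \<bar>h f a - h f b\<bar> + L * e" unfolding h by linarith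
      qed (use \<Phi>(2) in auto)
      finally have md: "m * d \<le> L * \<bar>h f a - h f b\<bar> + L\<^sup>2 * e"
        by (simp add: algebra_simps power2_eq_square)
      have e1: "1 * e \<le> L\<^sup>2 * e" using LL \<Phi>(2) nn by (intro mult_right_mono) auto
      \<comment> \<open>If the angular part dominates, the radial error is at most half of
        \<open>m * d\<close> and is absorbed, so \<open>h f\<close> separates the points with 5
        times \<open>2 * L\<close>. Otherwise \<open>fst\<close> does, with 4 plus 6 times
        \<open>L\<^sup>2\<close>.\<close>
      show ?thesis
      proof (cases "2 * (L\<^sup>2 * e) \<le> m * d")
        case True
        then have "?\<sigma> a b \<le> 10 * L * \<bar>h f a - h f b\<bar>" using md sig_le e1 by linarith
        also have "\<dots> \<le> C * \<bar>h f a - h f b\<bar>" using C by (intro mult_right_mono) auto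
        finally show ?thesis using f(1) by blast
      next
        case False
        then have "?\<sigma> a b \<le> 10 * (L\<^sup>2 * e)" using sig_le e1 by linarith
        then show ?thesis by (simp add: C_def y dem)
      qed
    qed
    ultimately show ?thesis by blast
  qed
  have sig_sym: "?\<sigma> a b = ?\<sigma> b a" for a b :: "real \<times> real"
    by (simp add: abs_minus_commute)
  have "bilip_coords ?\<sigma> ?A (insert fst (h ` \<Phi>)) C"
    unfolding bilip_coords_def
  proof (intro conjI ballI)
    fix g a b assume g: "g \<in> insert fst (h ` \<Phi>)" and ab: "a \<in> ?A" "b \<in> ?A"
    show "\<bar>g a - g b\<bar> \<le> C * ?\<sigma> a b"
    proof (cases "g = fst")
      case True
      have "\<bar>g a - g b\<bar> \<le> 1 * ?\<sigma> a b" by (simp add: True)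
      also have "\<dots> \<le> C * ?\<sigma> a b" using C by (intro mult_right_mono) auto
      finally show ?thesis .
    next
      case False
      then obtain f where f: "f \<in> \<Phi>" "g = h f" using g by blast
      consider "\<bar>fst b\<bar> \<le> \<bar>fst a\<bar>" | "\<bar>fst a\<bar> \<le> \<bar>fst b\<bar>" by linarith
      then show ?thesis
      proof cases
        case 1 then show ?thesis using main[OF ab] f by blast
      next
        case 2
        then have "\<bar>g b - g a\<bar> \<le> C * ?\<sigma> b a" using main[OF ab(2,1)] f by blast
        then show ?thesis by (simp only: sig_sym[of b a] abs_minus_commute[of "g b"])
      qed
    qed
  next
    fix a b assume ab: "a \<in> ?A" "b \<in> ?A"
    consider "\<bar>fst b\<bar> \<le> \<bar>fst a\<bar>" | "\<bar>fst a\<bar> \<le> \<bar>fst b\<bar>" by linarith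
    then show "\<exists>g\<in>insert fst (h ` \<Phi>). ?\<sigma> a b \<le> C * \<bar>g a - g b\<bar>"
    proof cases
      case 1 then show ?thesis using main[OF ab] by blast
    next
      case 2
      then have "\<exists>g\<in>insert fst (h ` \<Phi>). ?\<sigma> b a \<le> C * \<bar>g b - g a\<bar>"
        using main[OF ab(2,1)] by blast
      then show ?thesis
        by (subst sig_sym, subst abs_minus_commute)
    qed
  qed (use \<Phi> C in auto)
  then show ?thesis unfolding bilip_embeddable_def by blast
qed

section \<open>The Heisenberg distance\<close>

text \<open>\<^const>\<open>dH\<close> itself violates the triangle inequality; this comparable function satisfies it.\<close>
definition heis_dist :: "real^3 \<Rightarrow> real^3 \<Rightarrow> real" where
  "heis_dist w w' = max (\<bar>w$1 - w'$1\<bar> + \<bar>w$2 - w'$2\<bar>)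
     (sqrt \<bar>w$3 - w'$3 + (w$1 * w'$2 - w'$1 * w$2) / 2\<bar>)"

lemma heis_dist_le_dH: "heis_dist w w' \<le> dH w w'"
  and dH_le_heis_dist: "dH w w' \<le> 2 * heis_dist w w'"
  unfolding heis_dist_def dH_def by (auto simp: max_def)

text \<open>Below, \<open>q u v\<close> is the third coordinate of the group quotient of
  \<open>u\<close> by \<open>v\<close>. It is additive up to \<open>P / 2\<close>, where
  \<open>P\<close> is the determinant of the two horizontal displacements and is at most the product
  of their lengths. As a maximum, \<open>heis_dist\<close> dominates both the length and the root of
  \<open>q\<close>, so the error fits into the mixed term of the squared sum.\<close>

interpretation heis: pseudometric heis_dist
proof
  fix u v w :: "real^3"
  show "heis_dist u u = 0" by (simp add: heis_dist_def)
  have "u$3 - v$3 + (u$1 * v$2 - v$1 * u$2) / 2 = - (v$3 - u$3 + (v$1 * u$2 - u$1 * v$2) / 2)"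
    by (simp add: field_simps)
  then show "heis_dist u v = heis_dist v u"
    unfolding heis_dist_def by (metis abs_minus_cancel abs_minus_commute)
  define l where "l u v = \<bar>u$1 - v$1\<bar> + \<bar>u$2 - v$2\<bar>" for u v :: "real^3"
  define q where "q u v = u$3 - v$3 + (u$1 * v$2 - v$1 * u$2) / 2" for u v :: "real^3"
  have H: "heis_dist u v = max (l u v) (sqrt \<bar>q u v\<bar>)" for u v
    by (simp add: heis_dist_def l_def q_def)
  have l: "l u w \<le> l u v + l v w" "0 \<le> l u v" "0 \<le> l v w" by (auto simp: l_def)
  define P where "P = (u$1 - v$1) * (v$2 - w$2) - (u$2 - v$2) * (v$1 - w$1)"
  have q: "q u w = q u v + q v w - P / 2" by (simp add: q_def P_def field_simps)
  have "\<bar>P\<bar> \<le> \<bar>u$1 - v$1\<bar> * \<bar>v$2 - w$2\<bar> + \<bar>u$2 - v$2\<bar> * \<bar>v$1 - w$1\<bar>"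
    unfolding abs_mult[symmetric] P_def by simp
  also have "\<dots> \<le> l u v * l v w" by (simp add: l_def algebra_simps)
  finally have "\<bar>q u w\<bar> \<le> \<bar>q u v\<bar> + \<bar>q v w\<bar> + l u v * l v w"
    unfolding q by linarith
  also have "\<bar>q u v\<bar> \<le> (heis_dist u v)\<^sup>2" by (rule sqrt_le_D) (simp add: H)
  also have "\<bar>q v w\<bar> \<le> (heis_dist v w)\<^sup>2" by (rule sqrt_le_D) (simp add: H)
  also have "l u v * l v w \<le> 2 * (heis_dist u v * heis_dist v w)"
  proof -
    have "l u v * l v w \<le> heis_dist u v * heis_dist v w" using l by (intro mult_mono) (auto simp: H)
    moreover have "0 \<le> l u v * l v w" using l by simp
    ultimately show ?thesis by linarith
  qed
  finally have "\<bar>q u w\<bar> \<le> (heis_dist u v + heis_dist v w)\<^sup>2"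
    by (simp add: power2_eq_square algebra_simps)
  moreover have "0 \<le> heis_dist u v + heis_dist v w" using l by (auto simp: H)
  ultimately have "sqrt \<bar>q u w\<bar> \<le> heis_dist u v + heis_dist v w" by (rule real_le_lsqrt[rotated])
  moreover have "l u w \<le> heis_dist u v + heis_dist v w" using l by (simp add: H)
  ultimately show "heis_dist u w \<le> heis_dist u v + heis_dist v w" by (simp add: H[of u w])
qed

section \<open>Planes and simplices\<close>

text \<open>Charts are easier to compare with \<open>dH\<close>, which is a sum like the model
  metrics; the passage to \<open>heis_dist\<close> costs a factor 2.\<close>

lemma bilip_embeddable_heisI:
  assumes "bilip_embeddable \<sigma> B" "T ` A \<subseteq> B" "C \<ge> 1"
    and "\<And>a b. a \<in> A \<Longrightarrow> b \<in> A \<Longrightarrow> dH a b \<le> C * \<sigma> (T a) (T b)"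
    and "\<And>a b. a \<in> A \<Longrightarrow> b \<in> A \<Longrightarrow> \<sigma> (T a) (T b) \<le> C * dH a b"
  shows "bilip_embeddable heis_dist A"
proof (rule bilip_embeddable_pullback[OF assms(1,2), of "2 * C"])
  fix a b assume ab: "a \<in> A" "b \<in> A"
  show "heis_dist a b \<le> 2 * C * \<sigma> (T a) (T b)"
    using assms(4)[OF ab] heis_dist_le_dH[of a b] heis.nonneg[of a b] by linarith
  have "C * dH a b \<le> C * (2 * heis_dist a b)"
    using dH_le_heis_dist assms(3) by (intro mult_left_mono) auto
  then show "\<sigma> (T a) (T b) \<le> 2 * C * heis_dist a b" using assms(5)[OF ab] by simp
qed (use assms(3) in auto)

text \<open>The shift \<open>(x, y) \<mapsto> (x - 2\<beta>, y + 2\<alpha>)\<close> moves the characteristic point of the plane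
  \<open>z = \<alpha> x + \<beta> y + \<gamma>\<close> to the origin and absorbs the term \<open>z - z'\<close>.\<close>
lemma bilip_embeddable_graph:
  "bilip_embeddable heis_dist {w. w$3 = \<alpha> * w$1 + \<beta> * w$2 + \<gamma>}" (is "bilip_embeddable _ ?P")
proof -
  let ?\<sigma> = "\<lambda>p q. \<bar>fst p - fst q\<bar> + \<bar>snd p - snd q\<bar> + sqrt \<bar>fst p * snd q - fst q * snd p\<bar> :: real"
  define X where "X w = w$1 - 2 * \<beta>" for w :: "real^3"
  define Y where "Y w = w$2 + 2 * \<alpha>" for w :: "real^3"
  have dist: "\<bar>X a - X b\<bar> + \<bar>Y a - Y b\<bar> + sqrt \<bar>X a * Y b - X b * Y a\<bar> \<le> 2 * dH a b \<and>
      dH a b \<le> 2 * (\<bar>X a - X b\<bar> + \<bar>Y a - Y b\<bar> + sqrt \<bar>X a * Y b - X b * Y a\<bar>)"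
    if "a \<in> ?P" "b \<in> ?P" for a b
  proof -
    define v where "v = \<bar>a$3 - b$3 + (a$1 * b$2 - b$1 * a$2) / 2\<bar>"
    \<comment> \<open>The cross terms of the shift are
      \<open>2 * \<alpha> * (a$1 - b$1) + 2 * \<beta> * (a$2 - b$2)\<close>, which on the plane is
      twice the height difference. So the determinant is twice the vertical term, and the metrics
      differ by at most a factor \<open>sqrt 2\<close>.\<close>
    have "X a * Y b - X b * Y a = 2 * (a$3 - b$3) + (a$1 * b$2 - b$1 * a$2)"
      using that by (simp add: X_def Y_def algebra_simps)
    also have "\<dots> = 2 * (a$3 - b$3 + (a$1 * b$2 - b$1 * a$2) / 2)" by (simp add: field_simps)
    finally have eq: "X a * Y b - X b * Y a = 2 * (a$3 - b$3 + (a$1 * b$2 - b$1 * a$2) / 2)" .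
    define t where "t = sqrt \<bar>X a * Y b - X b * Y a\<bar>"
    define l where "l = \<bar>X a - X b\<bar> + \<bar>Y a - Y b\<bar>"
    have t: "t = sqrt (2 * v)" unfolding t_def eq abs_mult v_def by simp
    have "sqrt (2 * v) \<le> sqrt (4 * v)" "sqrt v \<le> sqrt (2 * v)"
      by (auto simp: v_def intro!: real_sqrt_le_mono)
    then have "t \<le> 2 * sqrt v" "sqrt v \<le> t" unfolding t by (auto simp: real_sqrt_mult)
    moreover have "dH a b = l + sqrt v" by (simp add: dH_def X_def Y_def v_def l_def)
    moreover have "0 \<le> sqrt v" "0 \<le> l" by (simp_all add: v_def l_def)
    ultimately show ?thesis unfolding t_def[symmetric] l_def[symmetric] by auto
  qed
  have "bilip_embeddable heis_dist {w \<in> ?P. \<bar>Y w\<bar> \<le> \<bar>X w\<bar>}"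
  proof (rule bilip_embeddable_heisI[OF bilip_embeddable_sector, of "\<lambda>w. (X w, Y w)" _ 2])
    fix a b assume "a \<in> {w \<in> ?P. \<bar>Y w\<bar> \<le> \<bar>X w\<bar>}" "b \<in> {w \<in> ?P. \<bar>Y w\<bar> \<le> \<bar>X w\<bar>}"
    then show "dH a b \<le> 2 * ?\<sigma> (X a, Y a) (X b, Y b)" "?\<sigma> (X a, Y a) (X b, Y b) \<le> 2 * dH a b"
      using dist[of a b] by auto
  qed auto
  \<comment> \<open>Steep directions lie outside the model sector; swapping the coordinates brings
    them inside and only flips the sign of the determinant.\<close>
  moreover have "bilip_embeddable heis_dist {w \<in> ?P. \<bar>X w\<bar> \<le> \<bar>Y w\<bar>}"
  proof (rule bilip_embeddable_heisI[OF bilip_embeddable_sector, of "\<lambda>w. (Y w, X w)" _ 2])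
    fix a b assume "a \<in> {w \<in> ?P. \<bar>X w\<bar> \<le> \<bar>Y w\<bar>}" "b \<in> {w \<in> ?P. \<bar>X w\<bar> \<le> \<bar>Y w\<bar>}"
    moreover have "\<bar>Y a * X b - Y b * X a\<bar> = \<bar>X a * Y b - X b * Y a\<bar>"
      by (simp add: mult.commute abs_minus_commute)
    ultimately show "dH a b \<le> 2 * ?\<sigma> (Y a, X a) (Y b, X b)" "?\<sigma> (Y a, X a) (Y b, X b) \<le> 2 * dH a b"
      using dist[of a b] by auto
  qed auto
  ultimately have "bilip_embeddable heis_dist
      ({w \<in> ?P. \<bar>Y w\<bar> \<le> \<bar>X w\<bar>} \<union> {w \<in> ?P. \<bar>X w\<bar> \<le> \<bar>Y w\<bar>})"
    by (rule heis.bilip_embeddable_Un)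
  then show ?thesis by (rule bilip_embeddable_subset) auto
qed

text \<open>Over a line in the horizontal plane, the twist
  \<open>(w$1 * w'$2 - w'$1 * w$2) / 2\<close> is a multiple of the difference of one coordinate. A
  shear of the height absorbs it and leaves the product metric of the strip, up to the slope factor
  \<open>1 + \<bar>m\<bar>\<close>; boundedness keeps the sheared height in a fixed
  interval.\<close>

lemma bilip_embeddable_vertical:
  assumes A: "bounded A"
    and plane: "(\<forall>w\<in>A. w$2 = m * w$1 + c) \<or> (\<forall>w\<in>A. w$1 = c)"
  shows "bilip_embeddable heis_dist A"
  using plane
proof
  let ?\<sigma> = "\<lambda>p q. \<bar>fst p - fst q\<bar> + sqrt \<bar>snd p - snd q\<bar> :: real"
  obtain M where M: "\<And>w. w \<in> A \<Longrightarrow> norm w \<le> M" using A by (auto simp: bounded_iff)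
  have comp: "\<bar>w$i\<bar> \<le> M" if "w \<in> A" for w i using M[OF that] component_le_norm_cart[of w i] by simp
  define R where "R = M + \<bar>c\<bar> * M / 2"
  have shift: "w$3 + c * w$i / 2 \<in> {-R..R}" "w$3 - c * w$i / 2 \<in> {-R..R}" if "w \<in> A" for w i
  proof -
    have "\<bar>c * w$i\<bar> \<le> \<bar>c\<bar> * M" unfolding abs_mult using comp[OF that] by (intro mult_left_mono) auto
    then show "w$3 + c * w$i / 2 \<in> {-R..R}" "w$3 - c * w$i / 2 \<in> {-R..R}"
      using comp[OF that, of 3] by (auto simp: R_def abs_le_iff)
  qed
  {
    assume w: "\<forall>w\<in>A. w$2 = m * w$1 + c"
    show ?thesis
    proof (rule bilip_embeddable_heisI[OF bilip_embeddable_strip[of R],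
        of "\<lambda>w. (w$1, w$3 + c * w$1 / 2)" _ "1 + \<bar>m\<bar>"])
      fix a b assume ab: "a \<in> A" "b \<in> A"
      let ?S = "sqrt \<bar>(a$3 + c * a$1 / 2) - (b$3 + c * b$1 / 2)\<bar>"
      have y: "a$2 = m * a$1 + c" "b$2 = m * b$1 + c" using w ab by auto
      have 1: "\<bar>a$2 - b$2\<bar> = \<bar>m\<bar> * \<bar>a$1 - b$1\<bar>" by (simp add: y abs_mult[symmetric] right_diff_distrib)
      have 2: "a$3 - b$3 + (a$1 * b$2 - b$1 * a$2) / 2 = (a$3 + c * a$1 / 2) - (b$3 + c * b$1 / 2)"
        by (simp add: y field_simps)
      have dH: "dH a b = (1 + \<bar>m\<bar>) * \<bar>a$1 - b$1\<bar> + ?S"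
        unfolding dH_def 1 2 by (simp add: distrib_right)
      have "0 \<le> ?S" by simp
      then have S: "?S \<le> (1 + \<bar>m\<bar>) * ?S" using mult_right_mono[of 1 "1 + \<bar>m\<bar>" ?S] by simp
      then show "dH a b \<le> (1 + \<bar>m\<bar>) * ?\<sigma> (a$1, a$3 + c * a$1 / 2) (b$1, b$3 + c * b$1 / 2)"
        unfolding dH by (simp add: distrib_left)
      have "0 \<le> dH a b" unfolding dH_def by simp
      then have "dH a b \<le> (1 + \<bar>m\<bar>) * dH a b" using mult_right_mono[of 1 "1 + \<bar>m\<bar>" "dH a b"] by simp
      moreover have "1 * \<bar>a$1 - b$1\<bar> \<le> (1 + \<bar>m\<bar>) * \<bar>a$1 - b$1\<bar>" by (intro mult_right_mono) auto
      ultimately show "?\<sigma> (a$1, a$3 + c * a$1 / 2) (b$1, b$3 + c * b$1 / 2) \<le> (1 + \<bar>m\<bar>) * dH a b"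
        using dH by simp
    qed (use shift in auto)
  next
    assume w: "\<forall>w\<in>A. w$1 = c"
    show ?thesis
    proof (rule bilip_embeddable_heisI[OF bilip_embeddable_strip[of R],
        of "\<lambda>w. (w$2, w$3 - c * w$2 / 2)" _ 1])
      fix a b assume ab: "a \<in> A" "b \<in> A"
      have x: "a$1 = c" "b$1 = c" using w ab by auto
      have 1: "a$3 - b$3 + (a$1 * b$2 - b$1 * a$2) / 2 = (a$3 - c * a$2 / 2) - (b$3 - c * b$2 / 2)"
        by (simp add: x field_simps)
      have "dH a b = ?\<sigma> (a$2, a$3 - c * a$2 / 2) (b$2, b$3 - c * b$2 / 2)"
        unfolding dH_def 1 by (simp add: x)
      then show "dH a b \<le> 1 * ?\<sigma> (a$2, a$3 - c * a$2 / 2) (b$2, b$3 - c * b$2 / 2)"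
        "?\<sigma> (a$2, a$3 - c * a$2 / 2) (b$2, b$3 - c * b$2 / 2) \<le> 1 * dH a b" by auto
    qed (use shift in auto)
  }
qed

lemma bilip_embeddable_planar:
  assumes A: "bounded A" and n: "n \<noteq> 0" "A \<subseteq> {w :: real^3. n \<bullet> w = c}"
  shows "bilip_embeddable heis_dist A"
proof -
  have eq: "n$1 * w$1 + n$2 * w$2 + n$3 * w$3 = c" if "w \<in> A" for w
    using n(2) that by (auto simp: inner_vec_def sum_3)
  consider "n$3 \<noteq> 0" | "n$3 = 0" "n$2 \<noteq> 0" | "n$3 = 0" "n$2 = 0" "n$1 \<noteq> 0"
    using n(1) by (auto simp: vec_eq_iff forall_3)
  then show ?thesis
  proof cases
    case 1
    have "w$3 = (- n$1 / n$3) * w$1 + (- n$2 / n$3) * w$2 + c / n$3" if "w \<in> A" for w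
      using eq[OF that] 1 by (simp add: field_simps)
    then show ?thesis
      by (intro bilip_embeddable_subset[OF
            bilip_embeddable_graph[of "- n$1 / n$3" "- n$2 / n$3" "c / n$3"]] subsetI CollectI)
  next
    case 2
    have "w$2 = (- n$1 / n$2) * w$1 + c / n$2" if "w \<in> A" for w
      using eq[OF that] 2 by (simp add: field_simps)
    then show ?thesis
      by (intro bilip_embeddable_vertical[OF A, of "- n$1 / n$2" "c / n$2"] disjI1 ballI)
  next
    case 3
    have "w$1 = c / n$1" if "w \<in> A" for w
      using eq[OF that] 3 by (simp add: field_simps)
    then show ?thesis by (intro bilip_embeddable_vertical[OF A]) auto
  qed
qed

text \<open>At most three points have affine dimension at most 2, so points, segments and triangles
  all lie in some plane and are treated at once.\<close>

lemma bilip_embeddable_simplex: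
  assumes "simplex_verts V"
  shows "bilip_embeddable heis_dist (convex hull V)"
proof -
  have V: "finite V" "card V \<le> 3" using assms by (auto simp: simplex_verts_def)
  then have "aff_dim V < DIM(real^3)" using aff_dim_le_card[of V] by simp
  then obtain n c where n: "n \<noteq> 0" "V \<subseteq> {w. n \<bullet> w = c}"
    by (rule aff_lowdim_subset_hyperplane)
  have "convex hull V \<subseteq> {w. n \<bullet> w = c}" by (intro hull_minimal n(2) convex_hyperplane)
  then show ?thesis
    by (intro bilip_embeddable_planar[OF _ n(1)] bounded_convex_hull finite_imp_bounded V(1))
qed

section \<open>From the maximum norm to Euclidean space\<close>

lemma bilip_embeddable_eucl_dist:
  assumes "bilip_embeddable \<rho> A"
  obtains N f L where "L \<ge> 1"
    "\<And>a b. a \<in> A \<Longrightarrow> b \<in> A \<Longrightarrow> \<rho> a b \<le> L * eucl_dist N (f a) (f b)"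
    "\<And>a b. a \<in> A \<Longrightarrow> b \<in> A \<Longrightarrow> eucl_dist N (f a) (f b) \<le> L * \<rho> a b"
\<comment> \<open>For empty \<open>A\<close> the coordinate set may be empty, and then
  \<open>L * card \<Phi>\<close> would be 0 instead of at least 1.\<close>
proof (cases "A = {}")
  case True then show thesis using that[of 1] by auto
next
  case False
  obtain \<Phi> L where \<Phi>: "finite \<Phi>" "L \<ge> 1"
    "\<And>f a b. f \<in> \<Phi> \<Longrightarrow> a \<in> A \<Longrightarrow> b \<in> A \<Longrightarrow> \<bar>f a - f b\<bar> \<le> L * \<rho> a b"
    "\<And>a b. a \<in> A \<Longrightarrow> b \<in> A \<Longrightarrow> \<exists>f\<in>\<Phi>. \<rho> a b \<le> L * \<bar>f a - f b\<bar>"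
    using bilip_embeddableE[OF assms] by metis
  obtain g where g: "bij_betw g {..<card \<Phi>} \<Phi>"
    using ex_bij_betw_nat_finite[OF \<Phi>(1)] by (auto simp: atLeast0LessThan)
  obtain a where "a \<in> A" using False by blast
  then have ne: "\<Phi> \<noteq> {}" using \<Phi>(4)[of a a] by auto
  then have N: "1 \<le> card \<Phi>" using \<Phi>(1) by (simp add: Suc_le_eq card_gt_0_iff)
  define F where "F a i = g i a" for a i
  have ed: "eucl_dist (card \<Phi>) (F a) (F b) = sqrt (\<Sum>f\<in>\<Phi>. (f a - f b)\<^sup>2)" for a b
    unfolding eucl_dist_def F_def
    by (subst sum.reindex_bij_betw[OF g, of "\<lambda>f. (f a - f b)\<^sup>2"]) (rule refl)
  show thesis
  proof (rule that[of "L * card \<Phi>" "card \<Phi>" F])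
    have "1 * 1 \<le> L * card \<Phi>" using \<Phi>(2) N by (intro mult_mono) auto
    then show "1 \<le> L * card \<Phi>" by simp
    have LN: "L * 1 \<le> L * card \<Phi>" using \<Phi>(2) N by (intro mult_left_mono) auto
    fix a b assume ab: "a \<in> A" "b \<in> A"
    obtain f where f: "f \<in> \<Phi>" "\<rho> a b \<le> L * \<bar>f a - f b\<bar>" using \<Phi>(4)[OF ab] by blast
    have "(f a - f b)\<^sup>2 \<le> (\<Sum>f\<in>\<Phi>. (f a - f b)\<^sup>2)"
      using \<Phi>(1) f(1) by (intro member_le_sum) auto
    then have "\<bar>f a - f b\<bar> \<le> eucl_dist (card \<Phi>) (F a) (F b)" unfolding ed by (intro real_le_rsqrt) auto
    then have "L * \<bar>f a - f b\<bar> \<le> L * card \<Phi> * eucl_dist (card \<Phi>) (F a) (F b)"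
      using LN \<Phi>(2) by (intro mult_mono) auto
    then show "\<rho> a b \<le> L * card \<Phi> * eucl_dist (card \<Phi>) (F a) (F b)" using f(2) by linarith
    have "eucl_dist (card \<Phi>) (F a) (F b) \<le> (\<Sum>f\<in>\<Phi>. \<bar>f a - f b\<bar>)"
      unfolding ed using L2_set_le_sum_abs[of "\<lambda>f. f a - f b" \<Phi>] by (simp add: L2_set_def)
    also have "\<dots> \<le> (\<Sum>f\<in>\<Phi>. L * \<rho> a b)" by (intro sum_mono \<Phi>(3) ab)
    finally show "eucl_dist (card \<Phi>) (F a) (F b) \<le> L * card \<Phi> * \<rho> a b" by (simp add: mult_ac)
  qed
qed

theorem theorem3p5:
  fixes D :: "nat \<Rightarrow> (real^3) set" and k :: nat and K :: "(real^3) set"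
  assumes "\<forall>i\<in>{1..k}. simplicial_2_complex (D i)"
    and "K = (\<Union>i\<in>{1..k}. D i)"
  shows "\<exists>(N::nat) (f :: real^3 \<Rightarrow> nat \<Rightarrow> real) (L::real). L \<ge> 1 \<and>
           (\<forall>a\<in>K. \<forall>b\<in>K. dH a b / L \<le> eucl_dist N (f a) (f b) \<and>
                          eucl_dist N (f a) (f b) \<le> L * dH a b)"
proof -
  have "bilip_embeddable heis_dist (D i)" if i: "i \<in> {1..k}" for i
  proof -
    have "simplicial_2_complex (D i)" using assms(1) i by blast
    then obtain Ss where "finite Ss" "\<forall>V\<in>Ss. simplex_verts V" "D i = (\<Union>V\<in>Ss. convex hull V)"
      unfolding simplicial_2_complex_def by (elim exE conjE)
    then show ?thesis by (auto intro: heis.bilip_embeddable_UN bilip_embeddable_simplex)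
  qed
  then have "bilip_embeddable heis_dist K"
    unfolding assms(2) by (intro heis.bilip_embeddable_UN) auto
  then obtain N f L where L: "L \<ge> 1"
    "\<And>a b. a \<in> K \<Longrightarrow> b \<in> K \<Longrightarrow> heis_dist a b \<le> L * eucl_dist N (f a) (f b)"
    "\<And>a b. a \<in> K \<Longrightarrow> b \<in> K \<Longrightarrow> eucl_dist N (f a) (f b) \<le> L * heis_dist a b"
    by (rule bilip_embeddable_eucl_dist) blast
  show ?thesis
  proof (intro exI conjI ballI)
    \<comment> \<open>The 2 pays for returning from \<open>heis_dist\<close> to \<open>dH\<close> in
      the lower bound.\<close>
    show "1 \<le> 2 * L" using L(1) by simp
    fix a b assume ab: "a \<in> K" "b \<in> K"
    show "dH a b / (2 * L) \<le> eucl_dist N (f a) (f b)"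
      using L(2)[OF ab] dH_le_heis_dist[of a b] L(1) by (simp add: field_simps)
    have "L * heis_dist a b \<le> L * dH a b" using heis_dist_le_dH L(1) by (intro mult_left_mono) auto
    moreover have "0 \<le> L * dH a b" using L(1) by (simp add: dH_def)
    ultimately show "eucl_dist N (f a) (f b) \<le> 2 * L * dH a b" using L(3)[OF ab] by linarith
  qed
qed

end
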